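(* Let $q\in\mathbb{C}$ with $0<|q|<1$, fix a square root $q^{1/2}$, and let $b\in\mathbb{C}\setminus\{0\}$. For every integer $n\ge0$, $$\frac{q^{\binom{n}{2}}S_{n}(bq^{-n};q)}{(-b)^{n}}=\sum_{j=0}^{\lfloor n/2\rfloor}\frac{q^{j^{2}-j}(-1)^{j}}{(q^{2};q^{2})_{j}}\frac{(b^{-1};q)_{n-2j}}{(q;q)_{n-2j}},$$ $$\frac{q^{\binom{n}{2}}S_{n}(-q^{-n+1/2}b;q)}{(-b)^{n}}=\sum_{k=0}^{n}\frac{q^{(k^{2}-k)/4}}{(q^{1/2};q^{1/2})_{k}}\frac{(b^{-1};q)_{n-k}}{(q;q)_{n-k}}(-1)^k,$$ $$\frac{q^{\binom{n}{2}}S_{n}(-q^{-n-1/2}b;q)}{(-b)^{n}}=\sum_{k=0}^{n}\frac{q^{(k^{2}-3k)/4}}{(q^{1/2};q^{1/2})_{k}}\frac{(b^{-1};q)_{n-k}}{(q;q)_{n-k}}(-1)^k.$$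
   Context: Notation: $(a;p)_n=\prod_{k=0}^{n-1}(1-ap^k)$. The Stieltjes--Wigert polynomials are $S_n(x;q)=\sum_{k=0}^n\frac{q^{k^2}}{(q;q)_k(q;q)_{n-k}}(-x)^k$. All powers of $q$ are integer powers of $q^{1/2}$, e.g. $q^{(k^2-k)/4}=(q^{1/2})^{k(k-1)/2}$ and $q^{(k^2-3k)/4}=(q^{1/2})^{k(k-3)/2}$. *)

theory Defs
  imports Complex_Main
begin

definition qpoch :: "complex \<Rightarrow> complex \<Rightarrow> nat \<Rightarrow> complex" where
  "qpoch a p n = (\<Prod>k<n. 1 - a * p ^ k)"

definition stieltjes_wigert :: "nat \<Rightarrow> complex \<Rightarrow> complex \<Rightarrow> complex" where
  "stieltjes_wigert n x q =
     (\<Sum>k=0..n. q ^ (k ^ 2) / (qpoch q q k * qpoch q q (n - k)) * (- x) ^ k)"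

end

theory Submission
  imports Defs "HOL-Computational_Algebra.Formal_Power_Series"
begin

text \<open>
  All three identities compare coefficients of \<open>t\<^sup>n\<close> in products of \<open>q\<close>-exponential series.
  Write \<open>(a t; p)\<^sub>\<infinity>\<close> for the formal power series with coefficients
  \<open>p\<^bsup>k choose 2\<^esup> (-a)\<^sup>k / (p; p)\<^sub>k\<close> (Euler) and let \<open>H(t)\<close> be the series with coefficients
  \<open>(c; q)\<^sub>n / (q; q)\<^sub>n\<close>, where \<open>c = 1/b\<close>. Since
  \<open>(n choose 2) = (m choose 2) + (k choose 2) + m k\<close> for \<open>n = m + k\<close>, the sum that defines
  \<open>S\<^sub>n\<close> becomes a Cauchy product, and the left-hand sides are the coefficients of \<open>(c t; q)\<^sub>\<infinity> (-z t; q)\<^sub>\<infinity>\<close>, where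
  \<open>z = 1\<close>, \<open>z = -s\<close> and \<open>z = -1/s\<close>, respectively
  (\<open>stieltjes_wigert_generating_function\<close>).

  The \<open>q\<close>-binomial theorem \<open>H(t) (t; q)\<^sub>\<infinity> = (c t; q)\<^sub>\<infinity>\<close> (\<open>q_binomial_theorem\<close>) then turns the left-hand side into
  the coefficient of \<open>H(t) (t; q)\<^sub>\<infinity> (-z t; q)\<^sub>\<infinity>\<close>, and the last two factors merge into one product:
  \<open>(t; q)\<^sub>\<infinity> (-t; q)\<^sub>\<infinity> = (t\<^sup>2; q\<^sup>2)\<^sub>\<infinity>\<close>, \<open>(t; q)\<^sub>\<infinity> (s t; q)\<^sub>\<infinity> = (t; s)\<^sub>\<infinity>\<close> and
  \<open>(t/s; q)\<^sub>\<infinity> (t; q)\<^sub>\<infinity> = (t/s; s)\<^sub>\<infinity>\<close> (\<open>euler_series_difference_of_squares\<close>,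
  \<open>euler_series_split_base\<close>). Expanding these gives the right-hand sides.

  Each of these product formulas is an identity between two series with constant term 1 that solve the
  same \<open>q\<close>-difference equation \<open>F(t) = R(t) F(q t)\<close> with \<open>R(0) = 1\<close>. Such a solution is determined
  by its constant term when no power \<open>q\<^sup>n\<close> with \<open>n > 0\<close> equals 1 (\<open>q_difference_eq_unique\<close>);
  for \<open>q\<close> and \<open>s\<close> this follows from \<open>|q| < 1\<close>.
\<close>

section \<open>Linear q-difference equations for formal power series\<close>

abbreviation q_dilate :: "complex \<Rightarrow> complex fps \<Rightarrow> complex fps" where
  "q_dilate q F \<equiv> fps_compose F (fps_const q * fps_X)"

lemma q_dilate_nth: "fps_nth (q_dilate q F) n = q ^ n * fps_nth F n"
  by (simp add: fps_compose_linear)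

lemma q_dilate_mult: "q_dilate q (F * G) = q_dilate q F * q_dilate q G"
  by (rule fps_compose_mult_distrib) simp

lemma q_dilate_q_dilate: "q_dilate p (q_dilate q F) = q_dilate (q * p) F"
  by (rule fps_ext) (simp add: q_dilate_nth power_mult_distrib)

text \<open>The difference of two solutions would have a lowest coefficient at some \<open>n > 0\<close>, and comparing
  coefficients there shows that it is \<open>q\<^sup>n\<close> times itself, with \<open>q\<^sup>n \<noteq> 1\<close>.\<close>
lemma q_difference_eq_unique:
  assumes nonroot: "\<And>n. n > 0 \<Longrightarrow> q ^ n \<noteq> 1"
    and F: "F = R * q_dilate q F" and G: "G = R * q_dilate q G"
    and R0: "fps_nth R 0 = 1" and FG0: "fps_nth F 0 = fps_nth G 0"
  shows "F = G"
proof -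
  define D where "D = F - G"
  have D: "D = R * q_dilate q D"
    unfolding D_def fps_compose_sub_distrib right_diff_distrib F[symmetric] G[symmetric] ..
  have "fps_nth D n = 0" for n
  proof (induction n rule: less_induct)
    case (less n)
    show ?case
    proof (cases "n = 0")
      case True
      thus ?thesis by (simp add: D_def FG0)
    next
      case False
      have "fps_nth D n = (\<Sum>i=0..n. fps_nth R i * (q ^ (n - i) * fps_nth D (n - i)))"
        by (subst D) (simp add: fps_mult_nth fps_compose_linear)
      \<comment> \<open>By induction, the coefficients of \<open>D\<close> below \<open>n\<close> vanish.\<close>
      also have "\<dots> = (\<Sum>i\<in>{0}. fps_nth R i * (q ^ (n - i) * fps_nth D (n - i)))"
        by (rule sum.mono_neutral_right) (auto intro!: less.IH)
      finally have "(1 - q ^ n) * fps_nth D n = 0"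
        by (simp add: R0 algebra_simps)
      with nonroot[of n] False show ?thesis by simp
    qed
  qed
  thus ?thesis by (simp add: D_def fps_eq_iff)
qed

section \<open>Euler's series and the q-binomial theorem\<close>

text \<open>The product \<open>(a t; p)\<^sub>\<infinity>\<close> in its expanded form.\<close>
definition euler_series :: "complex \<Rightarrow> complex \<Rightarrow> complex fps" where
  "euler_series p a = Abs_fps (\<lambda>n. p ^ (n choose 2) * (- a) ^ n / qpoch p p n)"

text \<open>The quotient \<open>(c t; q)\<^sub>\<infinity> / (t; q)\<^sub>\<infinity>\<close> in its expanded form.\<close>
definition q_binomial_series :: "complex \<Rightarrow> complex \<Rightarrow> complex fps" where
  "q_binomial_series q c = Abs_fps (\<lambda>n. qpoch c q n / qpoch q q n)"

lemma qpoch_0 [simp]: "qpoch a p 0 = 1"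
  by (simp add: qpoch_def)

lemma qpoch_Suc: "qpoch a p (Suc n) = qpoch a p n * (1 - a * p ^ n)"
  by (simp add: qpoch_def)

lemma qpoch_self_nonzero:
  assumes "\<And>n. n > 0 \<Longrightarrow> p ^ n \<noteq> 1"
  shows "qpoch p p n \<noteq> 0"
  using assms[of "Suc k" for k] by (auto simp: qpoch_def)

lemma euler_series_nth_0 [simp]: "fps_nth (euler_series p a) 0 = 1"
  by (simp add: euler_series_def numeral_2_eq_2)

lemma q_binomial_series_nth_0 [simp]: "fps_nth (q_binomial_series q c) 0 = 1"
  by (simp add: q_binomial_series_def)

lemma linear_factor_mult_nth_Suc:
  "fps_nth ((1 - fps_const a * fps_X) * F) (Suc n) = fps_nth F (Suc n) - a * fps_nth F n"
  for a :: complex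
  by (simp add: left_diff_distrib mult.assoc)

text \<open>Splitting off the first factor of \<open>(a t; p)\<^sub>\<infinity>\<close>.\<close>
lemma euler_series_rec:
  assumes nonroot: "\<And>n. n > 0 \<Longrightarrow> p ^ n \<noteq> 1"
  shows "euler_series p a = (1 - fps_const a * fps_X) * q_dilate p (euler_series p a)"
proof (rule fps_ext)
  fix n
  show "fps_nth (euler_series p a) n =
    fps_nth ((1 - fps_const a * fps_X) * q_dilate p (euler_series p a)) n"
  proof (cases n)
    case (Suc m)
    have nz: "qpoch p p m \<noteq> 0" "1 - p * p ^ m \<noteq> 0"
      using qpoch_self_nonzero[OF nonroot] nonroot[of "Suc m"] by auto
    have ch: "Suc m choose 2 = (m choose 2) + m"
      by (simp add: numeral_2_eq_2)
    show ?thesis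
      unfolding Suc linear_factor_mult_nth_Suc
      using nz unfolding q_dilate_nth
      by (simp add: euler_series_def qpoch_Suc ch power_add divide_simps) (simp add: algebra_simps)
  qed simp
qed

lemma q_binomial_series_rec:
  assumes nonroot: "\<And>n. n > 0 \<Longrightarrow> q ^ n \<noteq> 1"
  shows "(1 - fps_X) * q_binomial_series q c =
    (1 - fps_const c * fps_X) * q_dilate q (q_binomial_series q c)"
proof (rule fps_ext)
  fix n
  show "fps_nth ((1 - fps_X) * q_binomial_series q c) n =
    fps_nth ((1 - fps_const c * fps_X) * q_dilate q (q_binomial_series q c)) n"
  proof (cases n)
    case (Suc m)
    have nz: "qpoch q q m \<noteq> 0" "1 - q * q ^ m \<noteq> 0"
      using qpoch_self_nonzero[OF nonroot] nonroot[of "Suc m"] by auto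
    have X: "1 - fps_X = 1 - fps_const 1 * (fps_X :: complex fps)"
      by simp
    show ?thesis
      unfolding Suc X linear_factor_mult_nth_Suc
      using nz unfolding q_dilate_nth
      by (simp add: q_binomial_series_def qpoch_Suc divide_simps) (simp add: algebra_simps)
  qed simp
qed

text \<open>The \<open>q\<close>-binomial theorem with its denominator cleared: both sides solve
  \<open>F(t) = (1 - c t) F(q t)\<close>, since the factors \<open>1 - t\<close> of the two recurrences cancel.\<close>
theorem q_binomial_theorem:
  assumes nonroot: "\<And>n. n > 0 \<Longrightarrow> q ^ n \<noteq> 1"
  shows "q_binomial_series q c * euler_series q 1 = euler_series q c"
proof (rule q_difference_eq_unique[OF nonroot])
  let ?H = "q_binomial_series q c" and ?E = "euler_series q 1"
  have "?H * ?E = ((1 - fps_X) * ?H) * q_dilate q ?E"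
    by (subst euler_series_rec[OF nonroot]) (simp_all add: mult_ac)
  also have "\<dots> = (1 - fps_const c * fps_X) * q_dilate q (?H * ?E)"
    by (simp only: q_binomial_series_rec[OF nonroot] q_dilate_mult mult.assoc)
  finally show "?H * ?E = (1 - fps_const c * fps_X) * q_dilate q (?H * ?E)" .
  show "euler_series q c = (1 - fps_const c * fps_X) * q_dilate q (euler_series q c)"
    by (rule euler_series_rec[OF nonroot])
qed simp_all

lemma euler_series_mult_rec:
  assumes nonroot: "\<And>n. n > 0 \<Longrightarrow> q ^ n \<noteq> 1"
  shows "euler_series q a * euler_series q b =
    ((1 - fps_const a * fps_X) * (1 - fps_const b * fps_X)) *
      q_dilate q (euler_series q a * euler_series q b)"
proof -
  have "euler_series q a * euler_series q b =
      ((1 - fps_const a * fps_X) * q_dilate q (euler_series q a)) *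
      ((1 - fps_const b * fps_X) * q_dilate q (euler_series q b))"
    by (rule arg_cong2[where f = "(*)"]; rule euler_series_rec[OF nonroot])
  also have "\<dots> = ((1 - fps_const a * fps_X) * (1 - fps_const b * fps_X)) *
      q_dilate q (euler_series q a * euler_series q b)"
    unfolding q_dilate_mult by (simp only: mult_ac)
  finally show ?thesis .
qed

text \<open>Separating the even and the odd powers of \<open>s\<close>:
  \<open>(a t; s)\<^sub>\<infinity> = (a t; s\<^sup>2)\<^sub>\<infinity> (a s t; s\<^sup>2)\<^sub>\<infinity>\<close>. Two steps of the \<open>s\<close>-recurrence make
  one step of the \<open>s\<^sup>2\<close>-recurrence.\<close>
lemma euler_series_split_base:
  assumes nonroot: "\<And>n. n > 0 \<Longrightarrow> s ^ n \<noteq> 1"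
  shows "euler_series s a = euler_series (s\<^sup>2) a * euler_series (s\<^sup>2) (a * s)"
proof (rule q_difference_eq_unique)
  show nonroot2: "(s\<^sup>2) ^ n \<noteq> 1" if "n > 0" for n
    using nonroot[of "2 * n"] that by (simp add: power_mult)
  have lin: "q_dilate s (1 - fps_const a * fps_X) = 1 - fps_const (a * s) * fps_X"
    by (simp add: fps_compose_sub_distrib fps_compose_mult_distrib mult.assoc flip: fps_const_mult)
  have "euler_series s a = (1 - fps_const a * fps_X) *
      q_dilate s ((1 - fps_const a * fps_X) * q_dilate s (euler_series s a))"
    by (simp only: euler_series_rec[OF nonroot, symmetric])
  also have "\<dots> = ((1 - fps_const a * fps_X) * (1 - fps_const (a * s) * fps_X)) *
      q_dilate (s\<^sup>2) (euler_series s a)"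
    unfolding q_dilate_mult lin q_dilate_q_dilate by (simp add: power2_eq_square mult_ac)
  finally show "euler_series s a = \<dots>" .
  show "euler_series (s\<^sup>2) a * euler_series (s\<^sup>2) (a * s) =
    ((1 - fps_const a * fps_X) * (1 - fps_const (a * s) * fps_X)) *
      q_dilate (s\<^sup>2) (euler_series (s\<^sup>2) a * euler_series (s\<^sup>2) (a * s))"
    by (rule euler_series_mult_rec[OF nonroot2])
qed simp_all

text \<open>Factoring \<open>1 - q\<^bsup>2k\<^esup> t\<^sup>2\<close> in \<open>(t\<^sup>2; q\<^sup>2)\<^sub>\<infinity>\<close> as a difference of squares.\<close>
lemma euler_series_difference_of_squares:
  assumes nonroot: "\<And>n. n > 0 \<Longrightarrow> q ^ n \<noteq> 1"
  shows "euler_series (q\<^sup>2) 1 oo fps_X\<^sup>2 = euler_series q 1 * euler_series q (- 1)"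
proof (rule q_difference_eq_unique[OF nonroot])
  let ?E = "euler_series (q\<^sup>2) 1"
  let ?R = "(1 - fps_const 1 * fps_X) * (1 - fps_const (- 1) * fps_X) :: complex fps"
  have nonroot2: "(q\<^sup>2) ^ n \<noteq> 1" if "n > 0" for n
    using nonroot[of "2 * n"] that by (simp add: power_mult)
  have "q_dilate (q\<^sup>2) ?E oo fps_X\<^sup>2 = ?E oo (fps_const (q\<^sup>2) * fps_X\<^sup>2)"
    by (simp add: fps_compose_assoc[symmetric] fps_compose_mult_distrib)
  also have "fps_const (q\<^sup>2) * fps_X\<^sup>2 = q_dilate q (fps_X\<^sup>2)"
    by (simp add: fps_compose_power[symmetric] power_mult_distrib fps_const_power)
  also have "?E oo \<dots> = q_dilate q (?E oo fps_X\<^sup>2)"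
    by (rule fps_compose_assoc) simp_all
  finally have dil: "q_dilate (q\<^sup>2) ?E oo fps_X\<^sup>2 = q_dilate q (?E oo fps_X\<^sup>2)" .
  have "?E oo fps_X\<^sup>2 = ((1 - fps_const 1 * fps_X) * q_dilate (q\<^sup>2) ?E) oo fps_X\<^sup>2"
    by (simp only: euler_series_rec[OF nonroot2, symmetric])
  also have "\<dots> = (1 - fps_X\<^sup>2) * q_dilate q (?E oo fps_X\<^sup>2)"
    by (simp add: fps_compose_mult_distrib fps_compose_sub_distrib dil)
  also have "1 - fps_X\<^sup>2 = ?R"
    by (simp add: algebra_simps power2_eq_square flip: fps_const_neg)
  finally show "?E oo fps_X\<^sup>2 = ?R * q_dilate q (?E oo fps_X\<^sup>2)" .
  show "euler_series q 1 * euler_series q (- 1) =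
      ?R * q_dilate q (euler_series q 1 * euler_series q (- 1))"
    by (rule euler_series_mult_rec[OF nonroot])
qed simp_all

lemma fps_compose_X2_mult_nth:
  fixes F G :: "complex fps"
  shows "fps_nth ((F oo fps_X\<^sup>2) * G) n =
    (\<Sum>j=0..n div 2. fps_nth F j * fps_nth G (n - 2 * j))"
proof -
  have nth: "fps_nth (F oo fps_X\<^sup>2) i = (if even i then fps_nth F (i div 2) else 0)" for i
  proof -
    have "fps_nth (F oo fps_X\<^sup>2) i = (\<Sum>j=0..i. if i = 2 * j then fps_nth F j else 0)"
      by (auto simp: fps_compose_nth simp flip: power_mult intro!: sum.cong)
    also have "\<dots> = (if even i then fps_nth F (i div 2) else 0)"
    proof (cases "even i")
      case True
      hence "i = 2 * j \<longleftrightarrow> j = i div 2" for j by auto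
      thus ?thesis using True by (simp add: sum.delta)
    qed (auto intro!: sum.neutral)
    finally show ?thesis .
  qed
  have "fps_nth ((F oo fps_X\<^sup>2) * G) n =
      (\<Sum>i\<in>{0..n}. fps_nth (F oo fps_X\<^sup>2) i * fps_nth G (n - i))"
    by (simp add: fps_mult_nth)
  also have "\<dots> = (\<Sum>i\<in>(*) 2 ` {0..n div 2}. fps_nth (F oo fps_X\<^sup>2) i * fps_nth G (n - i))"
  proof (rule sum.mono_neutral_right)
    show "\<forall>i\<in>{0..n} - (*) 2 ` {0..n div 2}. fps_nth (F oo fps_X\<^sup>2) i * fps_nth G (n - i) = 0"
    proof
      fix i assume i: "i \<in> {0..n} - (*) 2 ` {0..n div 2}"
      have "odd i"
      proof
        assume "even i"
        hence "i = 2 * (i div 2)" by simp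
        moreover have "i div 2 \<in> {0..n div 2}" using i by (auto simp: div_le_mono)
        ultimately show False using i by blast
      qed
      thus "fps_nth (F oo fps_X\<^sup>2) i * fps_nth G (n - i) = 0" by (simp add: nth)
    qed
  qed auto
  also have "\<dots> = (\<Sum>j=0..n div 2. fps_nth F j * fps_nth G (n - 2 * j))"
    by (subst sum.reindex) (auto simp: inj_on_def nth)
  finally show ?thesis .
qed

section \<open>The Stieltjes--Wigert polynomials\<close>

lemma choose_two_add: "(m + k) choose 2 = (m choose 2) + (k choose 2) + m * k"
  by (induction m) (simp_all add: numeral_2_eq_2)

text \<open>At the argument \<open>b z q\<^bsup>-n\<^esup>\<close> the factor \<open>q\<^bsup>k\<^sup>2\<^esup>\<close> of the summand becomes
  \<open>q\<^bsup>-k(n-k)\<^esup>\<close>, which is just what is needed to split \<open>q\<^bsup>n choose 2\<^esup>\<close> between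
  the two factors of a Cauchy product.\<close>
lemma stieltjes_wigert_generating_function:
  assumes q0: "q \<noteq> 0" and b0: "b \<noteq> 0"
  shows "q ^ (n choose 2) * stieltjes_wigert n (b * z * q powi (- int n)) q / (- b) ^ n =
    fps_nth (euler_series q (- z) * euler_series q (inverse b)) n"
proof -
  have term_eq: "q ^ (n choose 2) * (q ^ (k ^ 2) / (qpoch q q k * qpoch q q (n - k))
        * (- (b * z * q powi (- int n))) ^ k) / (- b) ^ n =
      fps_nth (euler_series q (- z)) k * fps_nth (euler_series q (inverse b)) (n - k)"
    if "k \<le> n" for k
  proof -
    define m where "m = n - k"
    have n: "n = m + k" using that by (simp add: m_def)
    have q_power: "q ^ ((m + k) choose 2) * q ^ (k ^ 2) * (q powi (- int (m + k))) ^ k =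
        q ^ (k choose 2) * q ^ (m choose 2)"
    proof -
      have "k ^ 2 + m * k = (m + k) * k"
        by (simp add: power2_eq_square algebra_simps)
      hence "q ^ (k ^ 2) * q ^ (m * k) = (q ^ (m + k)) ^ k"
        by (simp only: power_add[symmetric] power_mult[symmetric])
      moreover have "(q powi (- int (m + k))) ^ k = inverse ((q ^ (m + k)) ^ k)"
        by (simp only: power_int_minus power_int_of_nat power_inverse)
      moreover have "(q ^ (m + k)) ^ k \<noteq> 0"
        using q0 by simp
      ultimately have "q ^ (k ^ 2) * q ^ (m * k) * (q powi (- int (m + k))) ^ k = 1"
        by (simp only: right_inverse not_False_eq_True)
      moreover have "q ^ ((m + k) choose 2) * q ^ (k ^ 2) * (q powi (- int (m + k))) ^ k =
          (q ^ (k choose 2) * q ^ (m choose 2)) *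
          (q ^ (k ^ 2) * q ^ (m * k) * (q powi (- int (m + k))) ^ k)"
        by (simp only: choose_two_add power_add mult_ac)
      ultimately show ?thesis by (simp only: mult_1_right)
    qed
    have "(- inverse b) ^ m = inverse ((- b) ^ m)"
      by (metis inverse_minus_eq power_inverse)
    hence b_power: "(- b) ^ k / (- b) ^ (m + k) = (- inverse b) ^ m"
      using b0 by (simp add: power_add divide_inverse)
    have "q ^ ((m + k) choose 2) * (q ^ (k ^ 2) / (qpoch q q k * qpoch q q m)
          * (- (b * z * q powi (- int (m + k)))) ^ k) / (- b) ^ (m + k) =
        (q ^ ((m + k) choose 2) * q ^ (k ^ 2) * (q powi (- int (m + k))) ^ k) * z ^ k
          * ((- b) ^ k / (- b) ^ (m + k)) / (qpoch q q k * qpoch q q m)"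
    proof -
      have "(- (b * z * q powi (- int (m + k)))) ^ k =
          (- b) ^ k * z ^ k * (q powi (- int (m + k))) ^ k"
        by (simp only: mult_minus_left[symmetric] power_mult_distrib)
      thus ?thesis
        by (simp only: times_divide_eq_left times_divide_eq_right divide_divide_eq_left mult_ac)
    qed
    also have "\<dots> = q ^ (k choose 2) * z ^ k / qpoch q q k *
        (q ^ (m choose 2) * (- inverse b) ^ m / qpoch q q m)"
      unfolding q_power b_power
      by (simp only: times_divide_eq_left times_divide_eq_right divide_divide_eq_left mult_ac)
    finally show ?thesis
      unfolding n by (simp only: euler_series_def fps_nth_Abs_fps minus_minus diff_add_inverse2)
  qed
  have "q ^ (n choose 2) * stieltjes_wigert n (b * z * q powi (- int n)) q / (- b) ^ n =
      (\<Sum>k=0..n. q ^ (n choose 2) * (q ^ (k ^ 2) / (qpoch q q k * qpoch q q (n - k))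
        * (- (b * z * q powi (- int n))) ^ k) / (- b) ^ n)"
    unfolding stieltjes_wigert_def by (simp only: sum_distrib_left sum_divide_distrib)
  also have "\<dots> = (\<Sum>k=0..n. fps_nth (euler_series q (- z)) k *
      fps_nth (euler_series q (inverse b)) (n - k))"
    by (rule sum.cong[OF refl], rule term_eq) simp
  finally show ?thesis by (simp only: fps_mult_nth)
qed

lemma stieltjes_wigert_q_binomial:
  assumes q0: "q \<noteq> 0" and b0: "b \<noteq> 0" and nonroot: "\<And>n. n > 0 \<Longrightarrow> q ^ n \<noteq> 1"
  shows "q ^ (n choose 2) * stieltjes_wigert n (b * z * q powi (- int n)) q / (- b) ^ n =
    fps_nth ((euler_series q 1 * euler_series q (- z)) * q_binomial_series q (inverse b)) n"
proof -
  have "euler_series q (- z) * euler_series q (inverse b) =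
      (euler_series q 1 * euler_series q (- z)) * q_binomial_series q (inverse b)"
    by (subst q_binomial_theorem[OF nonroot, symmetric]) (simp_all only: mult_ac)
  thus ?thesis
    by (simp only: stieltjes_wigert_generating_function[OF q0 b0])
qed

lemma powi_choose_two:
  "x powi (int k * (int k - 1) div 2) = x ^ (k choose 2)" for x :: complex
proof -
  have "int k * (int k - 1) div 2 = int (k choose 2)"
    by (cases k) (simp_all add: choose_two zdiv_int algebra_simps)
  thus ?thesis by simp
qed

theorem theorem4p1:
  fixes q s b :: complex and n :: nat
  assumes "0 < norm q" and "norm q < 1" and "s ^ 2 = q" and "b \<noteq> 0"
  shows "q ^ (n choose 2) * stieltjes_wigert n (b * q powi (- int n)) q / (- b) ^ n =
      (\<Sum>j=0..n div 2. q powi (int j ^ 2 - int j) * (- 1) ^ j / qpoch (q ^ 2) (q ^ 2) j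
        * (qpoch (inverse b) q (n - 2 * j) / qpoch q q (n - 2 * j)))
    \<and> q ^ (n choose 2) * stieltjes_wigert n (- (s powi (- 2 * int n + 1)) * b) q / (- b) ^ n =
      (\<Sum>k=0..n. s powi (int k * (int k - 1) div 2) / qpoch s s k
        * (qpoch (inverse b) q (n - k) / qpoch q q (n - k)) * (- 1) ^ k)
    \<and> q ^ (n choose 2) * stieltjes_wigert n (- (s powi (- 2 * int n - 1)) * b) q / (- b) ^ n =
      (\<Sum>k=0..n. s powi (int k * (int k - 3) div 2) / qpoch s s k
        * (qpoch (inverse b) q (n - k) / qpoch q q (n - k)) * (- 1) ^ k)"
proof (intro conjI)
  have q0: "q \<noteq> 0" and s0: "s \<noteq> 0"
    using assms by auto
  have nonroot: "q ^ m \<noteq> 1" if "m > 0" for m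
  proof
    assume "q ^ m = 1"
    hence "norm q ^ m = 1" by (metis norm_power norm_one)
    moreover have "norm q ^ m < 1" using assms(2) that by (simp add: power_less_one_iff)
    ultimately show False by simp
  qed
  have nonroot_s: "s ^ m \<noteq> 1" if "m > 0" for m
  proof
    assume "s ^ m = 1"
    hence "q ^ m = 1" by (metis assms(3) power_commutes power_mult power_one mult.commute)
    with nonroot[OF that] show False by simp
  qed
  note sw = stieltjes_wigert_q_binomial[OF q0 \<open>b \<noteq> 0\<close> nonroot]
  have split: "euler_series s a = euler_series q a * euler_series q (a * s)" for a
    using euler_series_split_base[OF nonroot_s, of a] unfolding assms(3) .
  have arg: "s powi (- 2 * int n) = q powi (- int n)"
    using power_int_mult[of s 2 "- int n"] assms(3) by simp

  have "q ^ (n choose 2) * stieltjes_wigert n (b * q powi (- int n)) q / (- b) ^ n =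
      fps_nth ((euler_series (q\<^sup>2) 1 oo fps_X\<^sup>2) * q_binomial_series q (inverse b)) n"
    using sw[of n 1] by (simp add: euler_series_difference_of_squares[OF nonroot])
  also have "\<dots> = (\<Sum>j=0..n div 2. q powi (int j ^ 2 - int j) * (- 1) ^ j / qpoch (q ^ 2) (q ^ 2) j
        * (qpoch (inverse b) q (n - 2 * j) / qpoch q q (n - 2 * j)))"
  proof -
    have "q powi (int j ^ 2 - int j) = (q\<^sup>2) ^ (j choose 2)" for j
    proof -
      have "int j ^ 2 - int j = 2 * (int j * (int j - 1) div 2)"
        by (simp add: power2_eq_square algebra_simps)
      hence "q powi (int j ^ 2 - int j) = (q powi 2) powi (int j * (int j - 1) div 2)"
        by (simp only: power_int_mult)
      thus ?thesis by (simp only: powi_choose_two) simp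
    qed
    thus ?thesis
      by (simp add: fps_compose_X2_mult_nth euler_series_def q_binomial_series_def)
  qed
  finally show "q ^ (n choose 2) * stieltjes_wigert n (b * q powi (- int n)) q / (- b) ^ n = \<dots>" .

  have "s powi (- 2 * int n + 1) = s * q powi (- int n)"
    unfolding arg[symmetric] using power_int_add[of s "- 2 * int n" 1] s0 by simp
  hence "q ^ (n choose 2) * stieltjes_wigert n (- (s powi (- 2 * int n + 1)) * b) q / (- b) ^ n =
      fps_nth (euler_series s 1 * q_binomial_series q (inverse b)) n"
    using sw[of n "- s"] split[of 1] by (simp add: mult_ac)
  also have "\<dots> = (\<Sum>k=0..n. s powi (int k * (int k - 1) div 2) / qpoch s s k
        * (qpoch (inverse b) q (n - k) / qpoch q q (n - k)) * (- 1) ^ k)"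
    unfolding fps_mult_nth
    by (simp add: euler_series_def q_binomial_series_def powi_choose_two mult_ac)
  finally show "q ^ (n choose 2) * stieltjes_wigert n (- (s powi (- 2 * int n + 1)) * b) q
      / (- b) ^ n = \<dots>" .

  \<comment> \<open>With \<open>a = 1/s\<close> the second factor after splitting the base is \<open>(a s t; q)\<^sub>\<infinity> = (t; q)\<^sub>\<infinity>\<close>.\<close>
  have "s powi (- 2 * int n - 1) = inverse s * q powi (- int n)"
    unfolding arg[symmetric] using power_int_add[of s "- 2 * int n" "- 1"] s0
    by (simp add: power_int_minus)
  hence "q ^ (n choose 2) * stieltjes_wigert n (- (s powi (- 2 * int n - 1)) * b) q / (- b) ^ n =
      fps_nth (euler_series s (inverse s) * q_binomial_series q (inverse b)) n"
    using sw[of n "- inverse s"] split[of "inverse s"] s0 by (simp add: mult_ac)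
  also have "\<dots> = (\<Sum>k=0..n. s powi (int k * (int k - 3) div 2) / qpoch s s k
        * (qpoch (inverse b) q (n - k) / qpoch q q (n - k)) * (- 1) ^ k)"
  proof -
    have "s powi (int k * (int k - 3) div 2) * (- 1) ^ k = s ^ (k choose 2) * (- inverse s) ^ k" for k
    proof -
      have "int k * (int k - 3) = int k * (int k - 1) + (- int k) * 2"
        by (simp add: algebra_simps)
      hence "int k * (int k - 3) div 2 = int k * (int k - 1) div 2 - int k"
        by simp
      hence "s powi (int k * (int k - 3) div 2) = s ^ (k choose 2) * inverse s ^ k"
        using s0 by (simp add: power_int_diff powi_choose_two power_inverse divide_inverse)
      thus ?thesis by (simp add: power_minus[of "inverse s"] mult_ac)
    qed
    hence "s powi (int k * (int k - 3) div 2) / qpoch s s k * w * (- 1) ^ k =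
        s ^ (k choose 2) * (- inverse s) ^ k / qpoch s s k * w" for k w
      by (metis times_divide_eq_left mult.commute mult.assoc)
    thus ?thesis
      by (simp only: fps_mult_nth euler_series_def q_binomial_series_def fps_nth_Abs_fps)
  qed
  finally show "q ^ (n choose 2) * stieltjes_wigert n (- (s powi (- 2 * int n - 1)) * b) q
      / (- b) ^ n = \<dots>" .
qed

end
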